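(* Consider a sequence of community detection problems indexed by $N\to\infty$ with parameters $n,p_0,p_1$ (depending on $N$) satisfying the standing assumptions of the context. If $$\liminf \frac{n\,H_{p_0}(p_1)}{2\log(N/n)}>1 ,$$ then the scan test is asymptotically powerful: with $$W^*_{[n]}=\max_{|S|=n}W_S,\qquad W_S=\sum_{i,j\in S,\ i<j}W_{i,j},$$ there is a sequence of thresholds $t_N$ such that the test $T_N=\mathbf 1\{W^*_{[n]}\ge t_N\}$ satisfies $\gamma_N(T_N)\to0$.
   Context: Observed data: the adjacency matrix $\boldsymbol{W}=(W_{i,j})\in\{0,1\}^{N\times N}$ (symmetric, zero diagonal) of a random undirected graph on the node set $\{1,\dots,N\}$. Let $0<p_0<p_1\le 1$. Under $\mathbb{P}_0$ (null), the $W_{i,j}$, $i<j$, are i.i.d. Bernoulli$(p_0)$. For $S\subset\{1,\dots,N\}$ with $|S|=n$, under $\mathbb{P}_S$ (alternative), the $W_{i,j}$, $i<j$, are independent, $\mathbb{P}_S(W_{i,j}=1)=p_1$ if $i,j\in S$, and $=p_0$ otherwise. A test $T$ is a function of $\boldsymbol{W}$ with values in $\{0,1\}$ (it may depend on $N,n,p_0,p_1$), and its risk is $\gamma_N(T)=\mathbb{P}_0(T=1)+\max_{|S|=n}\mathbb{P}_S(T=0)$. Entropy function: $H_p(q)=q\log\frac qp+(1-q)\log\frac{1-q}{1-p}$ (with $0\log 0=0$). Standing assumptions: $N\to\infty$; $n,p_0,p_1$ may depend on $N$; $n/N\to0$; $p_0$ is bounded away from $1$; $N^2p_0\to\infty$;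 and $n\to\infty$ with $n^2p_1\to\infty$. *)

theory Defs
  imports "HOL-Probability.Probability"
begin

definition node_pairs :: "nat \<Rightarrow> (nat \<times> nat) set" where
  "node_pairs N = {(i, j). 1 \<le> i \<and> i < j \<and> j \<le> N}"

text \<open>
  The function \<open>x\<close> is \<open>False\<close> outside \<open>node_pairs N\<close>, so reading the entry \<open>(i, j)\<close> off
  at \<open>(min i j, max i j)\<close> gives a symmetric matrix that vanishes on the diagonal and
  whenever an index is not a node.
\<close>

definition adjacency_pmf :: "nat \<Rightarrow> (nat \<Rightarrow> nat \<Rightarrow> real) \<Rightarrow> (nat \<Rightarrow> nat \<Rightarrow> nat) pmf" where
  "adjacency_pmf N p =
     map_pmf (\<lambda>x i j. of_bool (x (min i j, max i j)))
       (Pi_pmf (node_pairs N) False (\<lambda>(i, j). bernoulli_pmf (p i j)))"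

definition null_pmf :: "nat \<Rightarrow> real \<Rightarrow> (nat \<Rightarrow> nat \<Rightarrow> nat) pmf" where
  "null_pmf N p0 = adjacency_pmf N (\<lambda>i j. p0)"

definition alt_pmf :: "nat \<Rightarrow> real \<Rightarrow> real \<Rightarrow> nat set \<Rightarrow> (nat \<Rightarrow> nat \<Rightarrow> nat) pmf" where
  "alt_pmf N p0 p1 S = adjacency_pmf N (\<lambda>i j. if i \<in> S \<and> j \<in> S then p1 else p0)"

definition communities :: "nat \<Rightarrow> nat \<Rightarrow> nat set set" where
  "communities N n = {S. S \<subseteq> {1..N} \<and> card S = n}"

text \<open>
  The maxima below range over \<open>communities N n\<close>, which is finite, and nonempty
  if and only if \<open>n \<le> N\<close>; otherwise their values are unspecified.
\<close>

definition risk :: "nat \<Rightarrow> nat \<Rightarrow> real \<Rightarrow> real \<Rightarrow> ((nat \<Rightarrow> nat \<Rightarrow> nat) \<Rightarrow> nat) \<Rightarrow> real" where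
  "risk N n p0 p1 T =
     measure_pmf.prob (null_pmf N p0) {W. T W = 1} +
     Max ((\<lambda>S. measure_pmf.prob (alt_pmf N p0 p1 S) {W. T W = 0}) ` communities N n)"

definition edge_count :: "(nat \<Rightarrow> nat \<Rightarrow> nat) \<Rightarrow> nat set \<Rightarrow> nat" where
  "edge_count W S = (\<Sum>(i, j) \<in> {(i, j). i \<in> S \<and> j \<in> S \<and> i < j}. W i j)"

definition scan_stat :: "nat \<Rightarrow> nat \<Rightarrow> (nat \<Rightarrow> nat \<Rightarrow> nat) \<Rightarrow> nat" where
  "scan_stat N n W = Max (edge_count W ` communities N n)"

definition scan_test :: "nat \<Rightarrow> nat \<Rightarrow> real \<Rightarrow> (nat \<Rightarrow> nat \<Rightarrow> nat) \<Rightarrow> nat" where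
  "scan_test N n t W = (if real (scan_stat N n W) \<ge> t then 1 else 0)"

text \<open>
  The convention \<open>0 log 0 = 0\<close> holds automatically, since \<open>ln\<close> is total and
  multiplied by \<open>0\<close>.
\<close>

definition entropy_fn :: "real \<Rightarrow> real \<Rightarrow> real" where
  "entropy_fn p q = q * ln (q / p) + (1 - q) * ln ((1 - q) / (1 - p))"

end

theory Submission imports Defs begin

text \<open>
  Put \<open>m = n choose 2\<close> and take the threshold \<open>m q\<close> with \<open>q = p1 - l (p1 - p0)\<close> for a small
  constant \<open>l > 0\<close>. A union bound and Chernoff's inequality bound the type I error by
  \<open>exp (n (1 + ln (N / n)) - m H p0 q)\<close>, where \<open>H p0 q = entropy_fn p0 q\<close>. The point is that
  \<open>H p0 q \<ge> (1 - 12 sqrt l) H p0 p1\<close> uniformly in \<open>p0\<close> and \<open>p1\<close>, so that for small \<open>l\<close> the signal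
  condition still beats the entropy term \<open>n ln (N / n)\<close>. The type II error is at most
  \<open>exp (- m (p1 - q)\<^sup>2 / (4 p1))\<close>; here \<open>(p1 - p0)\<^sup>2 / p1\<close> is at least of order \<open>p1\<close> if
  \<open>p1 \<ge> 2 p0\<close>, and at least of order \<open>H p0 p1\<close> otherwise, by the chi-square bound on the entropy.
\<close>

section \<open>Entropy under contraction towards the null probability\<close>

text \<open>The integral of \<open>ln\<close> from 1 to \<open>y\<close>: convex, with minimum 0 at
  1. It generates the Kullback-Leibler divergence, and its linear part makes each summand
  nonnegative on its own.\<close>

definition phi :: "real \<Rightarrow> real" where
  "phi y = y * ln y - y + 1"

lemma phi_nonneg:
  assumes "0 \<le> y"
  shows "0 \<le> phi y"
proof (cases "y = 0")
  case False
  then have y: "y > 0" using assms by simp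
  have "ln (1 / y) \<le> 1 / y - 1" using y by (intro ln_le_minus_one) simp
  then have "y * (- ln y) \<le> y * (1 / y - 1)" using y by (intro mult_left_mono) (auto simp: ln_div)
  also have "\<dots> = 1 - y" using y by (simp add: field_simps)
  finally show ?thesis by (simp add: phi_def)
qed (simp add: phi_def)

text \<open>The linear parts of the two summands cancel. For \<open>q > p\<close> one argument of
  \<open>phi\<close> lies above 1 and the other below, so each can be contracted separately.\<close>

lemma entropy_fn_eq_phi:
  assumes "0 < p" "p < 1"
  shows "entropy_fn p q = p * phi (q / p) + (1 - p) * phi ((1 - q) / (1 - p))"
proof -
  have "p * phi (q / p) = q * ln (q / p) - q + p"
    using assms by (simp add: phi_def distrib_left right_diff_distrib)
  moreover have "(1 - p) * phi ((1 - q) / (1 - p))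
      = (1 - q) * ln ((1 - q) / (1 - p)) - (1 - q) + (1 - p)"
    unfolding phi_def distrib_left right_diff_distrib using assms by simp
  ultimately show ?thesis by (simp add: entropy_fn_def)
qed

text \<open>Equality holds at 1, and the difference has derivative
  \<open>ln u + 1 / u - 1 \<ge> 0\<close>. In terms of \<open>phi\<close> this reads
  \<open>(x - 1) * ln x \<le> 2 * phi x\<close>.\<close>

lemma ln_ge_two_mult_diff_div:
  fixes x :: real
  assumes "1 \<le> x"
  shows "2 * (x - 1) \<le> (x + 1) * ln x"
proof -
  let ?f = "\<lambda>x::real. (x + 1) * ln x - 2 * (x - 1)"
  have "?f 1 \<le> ?f x"
  proof (rule DERIV_nonneg_imp_nondecreasing[OF assms])
    fix u :: real assume u: "1 \<le> u"
    have "(?f has_real_derivative (1 * ln u + (1 / u) * (u + 1) - 2)) (at u)"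
      using u by (auto intro!: derivative_eq_intros)
    moreover have "ln (1 / u) \<le> 1 / u - 1" using u by (intro ln_le_minus_one) simp
    then have "0 \<le> 1 * ln u + (1 / u) * (u + 1) - 2"
      using u by (simp add: ln_div field_simps)
    ultimately show "\<exists>y. (?f has_real_derivative y) (at u) \<and> 0 \<le> y" by blast
  qed
  then show ?thesis by simp
qed

text \<open>By convexity \<open>phi\<close> drops by at most the step \<open>l * z\<close> times its
  slope \<open>ln (1 + z)\<close> at the far end, and
  \<open>z * ln (1 + z) \<le> 2 * phi (1 + z)\<close>.\<close>

lemma phi_contract_above:
  assumes z: "0 \<le> z" and l: "0 \<le> l" "l \<le> 1"
  shows "(1 - 2 * l) * phi (1 + z) \<le> phi (1 + (1 - l) * z)"
proof -
  define x x' where "x = 1 + z" and "x' = 1 + (1 - l) * z"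
  have x': "1 \<le> x'" "x' \<le> x" using z l by (auto simp: x_def x'_def mult_left_le_one_le)
  have "ln (x / x') \<le> x / x' - 1" using x' by (intro ln_le_minus_one) simp
  then have "x' * (ln x - ln x') \<le> x' * (x / x' - 1)"
    using x' by (intro mult_left_mono) (auto simp: ln_div)
  also have "\<dots> = x - x'" using x' by (simp add: field_simps)
  finally have "phi x - phi x' \<le> (x - x') * ln x"
    by (simp add: phi_def algebra_simps)
  also have "\<dots> = l * (z * ln x)" by (simp add: x_def x'_def algebra_simps)
  also have "z * ln x \<le> 2 * phi x"
    using ln_ge_two_mult_diff_div[of x] z by (simp add: x_def phi_def algebra_simps)
  then have "l * (z * ln x) \<le> l * (2 * phi x)" using l by (intro mult_left_mono)
  finally show ?thesis by (simp add: x_def x'_def algebra_simps)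
qed

text \<open>The logarithm bound at \<open>1 / sqrt y\<close> grows only like
  \<open>1 / sqrt y\<close> near 0; with \<open>1 / y\<close> in its place, the loss in the argument
  of \<open>phi_contract_below\<close> would not vanish with \<open>l\<close>.\<close>

lemma neg_ln_le_sqrt:
  fixes y :: real
  assumes "0 < y"
  shows "- ln y \<le> 2 * (1 / sqrt y - 1)"
proof -
  have "ln (1 / sqrt y) \<le> 1 / sqrt y - 1" using assms by (intro ln_le_minus_one) simp
  then show ?thesis using assms by (simp add: ln_div ln_sqrt)
qed

text \<open>With \<open>y = s\<^sup>2\<close>, \<open>phi y \<ge> (1 - s)\<^sup>2\<close>, while
  \<open>1 - y = (1 - s) * (1 + s) \<le> 2 * (1 - s)\<close>.\<close>

lemma phi_ge_square:
  assumes y: "0 \<le> y" "y \<le> 1"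
  shows "(1 - y)\<^sup>2 \<le> 4 * phi y"
proof (cases "y = 0")
  case False
  then have y0: "y > 0" using y by simp
  define s where "s = sqrt y"
  have s: "0 < s" "s \<le> 1" "y = s\<^sup>2" using y0 y by (auto simp: s_def)
  have "y * (- ln y) \<le> y * (2 * (1 / s - 1))"
    using neg_ln_le_sqrt[OF y0] y0 by (intro mult_left_mono) (auto simp: s_def)
  also have "\<dots> = 2 * s - 2 * y" using s by (simp add: power2_eq_square field_simps)
  finally have phi: "(1 - s)\<^sup>2 \<le> phi y" using s by (simp add: phi_def power2_eq_square algebra_simps)
  have "(1 - y)\<^sup>2 = (1 - s)\<^sup>2 * (1 + s)\<^sup>2"
    using s by (simp add: power2_eq_square algebra_simps)
  also have "\<dots> \<le> (1 - s)\<^sup>2 * 2\<^sup>2" using s by (intro mult_left_mono power_mono) auto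
  finally show ?thesis using phi by simp
qed (simp add: phi_def)

text \<open>The bound must be uniform up to \<open>z = 1\<close>, where the derivative of \<^const>\<open>phi\<close> is
  unbounded; this costs the square root of \<open>l\<close>.\<close>

lemma phi_contract_below:
  assumes z: "0 \<le> z" "z \<le> 1" and l: "0 < l" "l \<le> 1"
  shows "(1 - 12 * sqrt l) * phi (1 - z) \<le> phi (1 - (1 - l) * z)"
proof -
  define y y' where "y = 1 - z" and "y' = 1 - (1 - l) * z"
  have lz: "0 \<le> l * z" "(1 - l) * z \<le> 1 - l" using z l by (auto intro: mult_left_le)
  have y: "0 \<le> y" "y \<le> 1" "y' - y = l * z" using z by (auto simp: y_def y'_def algebra_simps)
  \<comment> \<open>The floor \<open>l \<le> y'\<close> holds even at \<open>z = 1\<close>, where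
    \<open>y = 0\<close>; it keeps \<open>ln y'\<close> under control.\<close>
  have y': "y \<le> y'" "l \<le> y'" "y' > 0" using y lz l by (auto simp: y'_def)
  have y'1: "y' \<le> 1" "1 - y' \<le> z" using z l by (auto simp: y'_def mult_left_le_one_le)
  have sl: "0 < sqrt l" "l = sqrt l * sqrt l" "l \<le> sqrt l" using l
    by (auto simp: real_le_rsqrt power2_eq_square mult_left_le)
  have sy: "sqrt l \<le> sqrt y'" using y' by simp
  have 1: "y * (ln y - ln y') \<le> - y * (l * z / y')"
  proof (cases "y = 0")
    case False
    then have "ln (y / y') \<le> y / y' - 1" using y y' by (intro ln_le_minus_one) simp
    then have "ln y - ln y' \<le> y / y' - 1" using False y y' by (simp add: ln_div)
    also have "\<dots> = - (l * z / y')" using y y' by (simp add: field_simps)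
    finally have "y * (ln y - ln y') \<le> y * (- (l * z / y'))" using y by (intro mult_left_mono)
    then show ?thesis by simp
  qed simp
  have 2: "l * z / y' \<le> z"
    using y' z l by (simp add: divide_le_eq mult.commute[of z] mult_right_mono)
  \<comment> \<open>The bound on \<open>- ln y'\<close> needs a factor \<open>z\<close>, so that the
    final loss is of order \<open>z\<^sup>2\<close>, like \<open>phi y\<close> near 1. It comes from
    \<open>1 - sqrt y' \<le> 1 - y' \<le> z\<close>.\<close>
  have "sqrt y' * sqrt y' \<le> sqrt y'" using y' y'1 by (intro mult_left_le) auto
  then have "1 - sqrt y' \<le> z" using y'1 y' by simp
  have "- ln y' \<le> 2 * (1 / sqrt y' - 1)" by (rule neg_ln_le_sqrt[OF y'(3)])
  also have "\<dots> = 2 * (1 - sqrt y') / sqrt y'" using y' by (simp add: field_simps)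
  also have "\<dots> \<le> 2 * z / sqrt l" using \<open>1 - sqrt y' \<le> z\<close> sy sl z y'1
    by (intro frac_le) auto
  finally have 3: "- ln y' \<le> 2 * z / sqrt l" .
  \<comment> \<open>The first-order parts cancel: \<open>1 - y / y' = l * z / y'\<close>, which is
    again at most \<open>z\<close>.\<close>
  have "phi y - phi y' = y * (ln y - ln y') + (y' - y) * (1 - ln y')"
    by (simp add: phi_def algebra_simps)
  also have "\<dots> \<le> - y * (l * z / y') + (l * z) * (1 - ln y')" using 1 y by simp
  also have "\<dots> = (l * z) * ((y' - y) / y' - ln y')" using y' by (simp add: field_simps)
  also have "\<dots> \<le> (l * z) * (z + 2 * z / sqrt l)"
    using 2 3 lz y by (intro mult_left_mono add_mono) auto
  also have "\<dots> = l * z\<^sup>2 + 2 * sqrt l * z\<^sup>2"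
  proof -
    have "l / sqrt l = sqrt l" using sl by (metis nonzero_mult_div_cancel_left less_numeral_extra(3))
    then have "l * z * (2 * z / sqrt l) = 2 * sqrt l * z\<^sup>2"
      by (metis (no_types, opaque_lifting) mult.commute mult.left_commute power2_eq_square times_divide_eq_left)
    then show ?thesis by (simp add: distrib_left power2_eq_square)
  qed
  also have "\<dots> \<le> sqrt l * z\<^sup>2 + 2 * sqrt l * z\<^sup>2" using sl by (intro add_right_mono mult_right_mono) auto
  also have "\<dots> = 3 * sqrt l * (1 - y)\<^sup>2" by (simp add: y_def)
  \<comment> \<open>The constant 12 arises here as 3 * 4.\<close>
  also have "\<dots> \<le> 3 * sqrt l * (4 * phi y)"
    using sl phi_ge_square[OF y(1,2)] by (intro mult_left_mono) auto
  finally show ?thesis by (simp add: y_def y'_def algebra_simps)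
qed

text \<open>Moving \<open>q\<close> towards \<open>p\<close> shrinks both relative deviations
  \<open>z\<close> and \<open>w\<close> by the same factor \<open>1 - l\<close>. The upward part
  loses only \<open>2 * l\<close>, which is below \<open>12 * sqrt l\<close>.\<close>

lemma entropy_fn_contract:
  assumes p: "0 < p" "p < q" "q \<le> 1" and l: "0 < l" "l \<le> 1"
  shows "(1 - 12 * sqrt l) * entropy_fn p q \<le> entropy_fn p (q - l * (q - p))"
proof -
  define z w where "z = (q - p) / p" and "w = (q - p) / (1 - p)"
  have z: "0 \<le> z" and w: "0 \<le> w" "w \<le> 1" using p by (auto simp: z_def w_def)
  have eq: "q / p = 1 + z" "(1 - q) / (1 - p) = 1 - w"
    "(q - l * (q - p)) / p = 1 + (1 - l) * z"
    "(1 - (q - l * (q - p))) / (1 - p) = 1 - (1 - l) * w"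
    using p by (auto simp: z_def w_def field_simps)
  have "l \<le> sqrt l" using l by (simp add: real_le_rsqrt power2_eq_square mult_left_le)
  then have "(1 - 12 * sqrt l) * phi (1 + z) \<le> (1 - 2 * l) * phi (1 + z)"
    using z l by (intro mult_right_mono phi_nonneg) auto
  also have "\<dots> \<le> phi (1 + (1 - l) * z)" using z l by (intro phi_contract_above) auto
  finally have a: "(1 - 12 * sqrt l) * phi (1 + z) \<le> phi (1 + (1 - l) * z)" .
  have b: "(1 - 12 * sqrt l) * phi (1 - w) \<le> phi (1 - (1 - l) * w)"
    using w l by (intro phi_contract_below) auto
  have "p * ((1 - 12 * sqrt l) * phi (1 + z)) + (1 - p) * ((1 - 12 * sqrt l) * phi (1 - w))
      \<le> p * phi (1 + (1 - l) * z) + (1 - p) * phi (1 - (1 - l) * w)"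
    using a b p by (intro add_mono mult_left_mono) auto
  moreover have "entropy_fn p q = p * phi (1 + z) + (1 - p) * phi (1 - w)"
    using p by (simp add: entropy_fn_eq_phi flip: eq)
  moreover have "entropy_fn p (q - l * (q - p))
      = p * phi (1 + (1 - l) * z) + (1 - p) * phi (1 - (1 - l) * w)"
    unfolding eq(3,4)[symmetric] using p by (intro entropy_fn_eq_phi) auto
  ultimately show ?thesis by (simp add: distrib_left mult.left_commute)
qed

text \<open>Apply \<open>ln x \<le> x - 1\<close> to both logarithms; the right-hand side is the
  chi-square divergence. At \<open>q = 1\<close> the second term is 0.\<close>

lemma entropy_fn_le_chi_square:
  assumes p: "0 < p" "p < 1" and q: "0 < q" "q \<le> 1"
  shows "entropy_fn p q \<le> (q - p)\<^sup>2 / (p * (1 - p))"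
proof -
  have "q * ln (q / p) \<le> q * (q / p - 1)"
    using p q by (intro mult_left_mono ln_le_minus_one) auto
  moreover have "(1 - q) * ln ((1 - q) / (1 - p)) \<le> (1 - q) * ((1 - q) / (1 - p) - 1)"
  proof (cases "q = 1")
    case False
    then show ?thesis using p q by (intro mult_left_mono ln_le_minus_one) auto
  qed simp
  moreover have "q * (q / p - 1) + (1 - q) * ((1 - q) / (1 - p) - 1) = (q - p)\<^sup>2 / (p * (1 - p))"
    using p by (simp add: field_simps power2_eq_square)
  ultimately show ?thesis unfolding entropy_fn_def by linarith
qed

lemma entropy_fn_nonneg:
  assumes "0 < p" "p < 1" "0 \<le> q" "q \<le> 1"
  shows "0 \<le> entropy_fn p q"
  using assms by (simp add: entropy_fn_eq_phi phi_nonneg)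

text \<open>If \<open>q \<ge> 2 * p\<close>, then \<open>q - p \<ge> q / 2\<close>. Otherwise
  \<open>p\<close> and \<open>q\<close> are comparable and the chi-square bound applies;
  \<open>c\<close> keeps its factor \<open>1 - p\<close> away from 0.\<close>

lemma min_le_square_diff_div:
  assumes p: "0 < p" "p < q" "q \<le> 1" and c: "p \<le> c"
  shows "min (q / 4) ((1 - c) / 2 * entropy_fn p q) \<le> (q - p)\<^sup>2 / q"
proof (cases "q \<ge> 2 * p")
  case True
  have "(q / 2)\<^sup>2 \<le> (q - p)\<^sup>2" using True p by (intro power_mono) auto
  then have "q / 4 \<le> (q - p)\<^sup>2 / q" using p by (simp add: field_simps power2_eq_square)
  then show ?thesis by linarith
next
  case False
  have "(1 - c) / 2 * entropy_fn p q \<le> (1 - p) / 2 * entropy_fn p q"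
    using p c by (intro mult_right_mono entropy_fn_nonneg) auto
  also have "\<dots> \<le> (1 - p) / 2 * ((q - p)\<^sup>2 / (p * (1 - p)))"
    using p by (intro mult_left_mono entropy_fn_le_chi_square) auto
  also have "\<dots> = (q - p)\<^sup>2 / (2 * p)" using p by (simp add: field_simps)
  also have "\<dots> \<le> (q - p)\<^sup>2 / q" using False p by (intro divide_left_mono) auto
  finally show ?thesis by linarith
qed

section \<open>Edge counts: exponential moments and tail bounds\<close>

definition pairs_of :: "nat set \<Rightarrow> (nat \<times> nat) set" where
  "pairs_of S = {(i, j). i \<in> S \<and> j \<in> S \<and> i < j}"

lemma finite_pairs_of: "finite S \<Longrightarrow> finite (pairs_of S)"
  by (rule finite_subset[of _ "S \<times> S"]) (auto simp: pairs_of_def)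

text \<open>Inserting a new largest element \<open>b\<close> adds exactly the pairs
  \<open>(i, b)\<close> with \<open>i \<in> A\<close>.\<close>

lemma card_pairs_of:
  assumes "finite S"
  shows "card (pairs_of S) = card S choose 2"
  using assms
proof (induction S rule: finite_linorder_max_induct)
  case (insert b A)
  have eq: "pairs_of (insert b A) = pairs_of A \<union> A \<times> {b}"
    using insert.hyps by (fastforce simp: pairs_of_def)
  have "b \<notin> A" using insert.hyps by auto
  then have "card (pairs_of (insert b A)) = card (pairs_of A) + card (A \<times> {b})"
    unfolding eq using insert.hyps
    by (intro card_Un_disjoint finite_pairs_of) (auto simp: pairs_of_def)
  then show ?case using insert \<open>b \<notin> A\<close> by (simp add: card_cartesian_product eval_nat_numeral)
qed (simp add: pairs_of_def)

lemma node_pairs_eq_pairs_of: "node_pairs N = pairs_of {1..N}"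
  by (auto simp: node_pairs_def pairs_of_def)

lemma finite_node_pairs: "finite (node_pairs N)"
  by (simp add: node_pairs_eq_pairs_of finite_pairs_of)

lemma finite_set_adjacency_pmf: "finite (set_pmf (adjacency_pmf N p))"
  unfolding adjacency_pmf_def
  by (simp add: set_Pi_pmf finite_node_pairs finite_PiE_dflt)

text \<open>Inside \<open>S\<close> the entries are independent with parameter \<open>r\<close>, so
  the moment generating function factorises. Fixing \<open>p\<close> only on \<open>S\<close> covers
  both the null (\<open>r = p0\<close>) and the planted community (\<open>r = p1\<close>).\<close>

lemma expectation_exp_edge_count:
  assumes S: "S \<subseteq> {1..N}" and r: "0 \<le> r" "r \<le> 1"
    and p: "\<And>i j. i \<in> S \<Longrightarrow> j \<in> S \<Longrightarrow> p i j = r"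
  shows "measure_pmf.expectation (adjacency_pmf N p) (\<lambda>W. exp (\<theta> * real (edge_count W S)))
       = (1 - r + r * exp \<theta>) ^ (card S choose 2)"
proof -
  have fS: "finite S" using S finite_subset by blast
  have sub: "pairs_of S \<subseteq> node_pairs N" using S by (auto simp: pairs_of_def node_pairs_def)
  \<comment> \<open>Pairs outside \<open>S\<close> get the factor 1, so that the product runs over
    the whole index set of \<open>Pi_pmf\<close>.\<close>
  let ?f = "\<lambda>e v. if e \<in> pairs_of S then exp (\<theta> * of_bool v) else 1"
  have "exp (\<theta> * real (edge_count (\<lambda>i j. of_bool (x (min i j, max i j))) S))
      = (\<Prod>e\<in>node_pairs N. ?f e (x e))" for x
  proof -
    have "edge_count (\<lambda>i j. of_bool (x (min i j, max i j))) S = (\<Sum>e\<in>pairs_of S. of_bool (x e))"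
      unfolding edge_count_def pairs_of_def by (intro sum.cong) auto
    then have "exp (\<theta> * real (edge_count (\<lambda>i j. of_bool (x (min i j, max i j))) S))
        = (\<Prod>e\<in>pairs_of S. exp (\<theta> * of_bool (x e)))"
      by (simp add: sum_distrib_left exp_sum finite_pairs_of fS
          del: sum_of_bool_eq sum_mult_of_bool_eq of_bool_eq)
    also have "\<dots> = (\<Prod>e\<in>pairs_of S. ?f e (x e))" by (intro prod.cong) auto
    also have "\<dots> = (\<Prod>e\<in>node_pairs N. ?f e (x e))"
      by (intro prod.mono_neutral_left finite_node_pairs sub) auto
    finally show ?thesis .
  qed
  then have "measure_pmf.expectation (adjacency_pmf N p) (\<lambda>W. exp (\<theta> * real (edge_count W S)))
      = measure_pmf.expectation (Pi_pmf (node_pairs N) False (\<lambda>(i, j). bernoulli_pmf (p i j)))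
          (\<lambda>x. \<Prod>e\<in>node_pairs N. ?f e (x e))"
    by (simp add: adjacency_pmf_def)
  also have "\<dots> = (\<Prod>e\<in>node_pairs N.
      measure_pmf.expectation (case e of (i, j) \<Rightarrow> bernoulli_pmf (p i j)) (?f e))"
    by (intro expectation_prod_Pi_pmf finite_node_pairs integrable_measure_pmf_finite) auto
  also have "\<dots> = (\<Prod>e\<in>node_pairs N. if e \<in> pairs_of S then 1 - r + r * exp \<theta> else 1)"
  proof (intro prod.cong refl)
    fix e assume "e \<in> node_pairs N"
    show "measure_pmf.expectation (case e of (i, j) \<Rightarrow> bernoulli_pmf (p i j)) (?f e)
        = (if e \<in> pairs_of S then 1 - r + r * exp \<theta> else 1)"
    proof (cases "e \<in> pairs_of S")
      case True
      then obtain i j where "e = (i, j)" "i \<in> S" "j \<in> S" by (auto simp: pairs_of_def)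
      then show ?thesis using True r p by simp
    qed (simp split: prod.split)
  qed
  also have "\<dots> = (\<Prod>e\<in>pairs_of S. 1 - r + r * exp \<theta>)"
    by (subst prod.mono_neutral_right[OF finite_node_pairs sub]) auto
  finally show ?thesis by (simp add: card_pairs_of fS)
qed

text \<open>For \<open>\<theta> > 0\<close> this controls the upper tail of the edge count, for \<open>\<theta> < 0\<close> the lower one.\<close>

lemma prob_edge_count_chernoff:
  assumes S: "S \<subseteq> {1..N}" and r: "0 \<le> r" "r \<le> 1"
    and p: "\<And>i j. i \<in> S \<Longrightarrow> j \<in> S \<Longrightarrow> p i j = r"
  shows "measure_pmf.prob (adjacency_pmf N p) {W. \<theta> * a \<le> \<theta> * real (edge_count W S)}
       \<le> (1 - r + r * exp \<theta>) ^ (card S choose 2) / exp (\<theta> * a)"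
proof -
  have "measure (adjacency_pmf N p)
      {W \<in> space (adjacency_pmf N p). exp (\<theta> * a) \<le> exp (\<theta> * real (edge_count W S))}
    \<le> measure_pmf.expectation (adjacency_pmf N p) (\<lambda>W. exp (\<theta> * real (edge_count W S))) / exp (\<theta> * a)"
    by (rule integral_Markov_inequality_measure[where A = "{}"])
      (auto intro: integrable_measure_pmf_finite finite_set_adjacency_pmf)
  then show ?thesis using expectation_exp_edge_count[OF assms] by simp
qed

lemma prob_edge_count_ge:
  assumes S: "S \<subseteq> {1..N}" and q: "0 < r" "r < q" "q < 1"
    and p: "\<And>i j. i \<in> S \<Longrightarrow> j \<in> S \<Longrightarrow> p i j = r"
  defines "m \<equiv> card S choose 2"
  shows "measure_pmf.prob (adjacency_pmf N p) {W. real m * q \<le> real (edge_count W S)}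
       \<le> exp (- real m * entropy_fn r q)"
proof -
  \<comment> \<open>The optimal tilt, the log odds ratio of \<open>q\<close> against
    \<open>r\<close>, makes the exponent exactly the entropy.\<close>
  define \<theta> where "\<theta> = ln (q / r) - ln ((1 - q) / (1 - r))"
  have "ln (q / r) > 0" "ln ((1 - q) / (1 - r)) < 0" using q by auto
  then have \<theta>: "\<theta> > 0" by (simp add: \<theta>_def)
  have "exp \<theta> = (q / r) / ((1 - q) / (1 - r))" using q by (simp add: \<theta>_def exp_diff)
  then have "1 - r + r * exp \<theta> = (1 - r) / (1 - q)" using q by (simp add: field_simps)
  also have "\<dots> = exp (- ln ((1 - q) / (1 - r)))" using q by (simp add: exp_minus)
  finally have base: "1 - r + r * exp \<theta> = exp (- ln ((1 - q) / (1 - r)))" .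
  have "measure_pmf.prob (adjacency_pmf N p) {W. real m * q \<le> real (edge_count W S)}
      = measure_pmf.prob (adjacency_pmf N p) {W. \<theta> * (real m * q) \<le> \<theta> * real (edge_count W S)}"
    using \<theta> by simp
  also have "\<dots> \<le> (1 - r + r * exp \<theta>) ^ m / exp (\<theta> * (real m * q))"
    unfolding m_def using q by (intro prob_edge_count_chernoff[OF S _ _ p]) auto
  also have "\<dots> = exp (- real m * entropy_fn r q)"
    unfolding base exp_of_nat_mult[symmetric] exp_diff[symmetric]
    by (simp add: entropy_fn_def \<theta>_def algebra_simps)
  finally show ?thesis .
qed

text \<open>Missed detections only need an exponent of order \<open>(r - q)\<^sup>2 / r\<close>, so
  a quadratic bound on the exponential moment replaces the entropy.\<close>

lemma prob_edge_count_less: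
  assumes S: "S \<subseteq> {1..N}" and q: "0 < r" "q < r" "r \<le> 1"
    and p: "\<And>i j. i \<in> S \<Longrightarrow> j \<in> S \<Longrightarrow> p i j = r"
  defines "m \<equiv> card S choose 2"
  shows "measure_pmf.prob (adjacency_pmf N p) {W. real (edge_count W S) < real m * q}
       \<le> exp (- real m * ((r - q)\<^sup>2 / (4 * r)))"
proof -
  \<comment> \<open>Minimises the exponent \<open>r * \<theta>\<^sup>2 - \<theta> * (r - q)\<close>
    reached below.\<close>
  define \<theta> where "\<theta> = (r - q) / (2 * r)"
  have \<theta>: "\<theta> > 0" using q by (simp add: \<theta>_def)
  have "exp (- \<theta>) \<le> 1 / (1 + \<theta>)"
    using exp_ge_add_one_self[of \<theta>] \<theta> by (simp add: exp_minus inverse_eq_divide frac_le)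
  \<comment> \<open>Since \<open>(1 + \<theta>) * (1 - \<theta> + \<theta>\<^sup>2) = 1 + \<theta> ^
    3\<close>.\<close>
  also have "\<dots> \<le> 1 - \<theta> + \<theta>\<^sup>2" using \<theta> by (simp add: field_simps power2_eq_square)
  finally have "r * exp (- \<theta>) \<le> r * (1 - \<theta> + \<theta>\<^sup>2)" using q by (intro mult_left_mono) auto
  then have "1 - r + r * exp (- \<theta>) \<le> 1 + r * (\<theta>\<^sup>2 - \<theta>)" by (simp add: algebra_simps)
  also have "\<dots> \<le> exp (r * (\<theta>\<^sup>2 - \<theta>))" by (rule exp_ge_add_one_self)
  finally have base: "1 - r + r * exp (- \<theta>) \<le> exp (r * (\<theta>\<^sup>2 - \<theta>))" .
  have "measure_pmf.prob (adjacency_pmf N p) {W. real (edge_count W S) < real m * q}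
      \<le> measure_pmf.prob (adjacency_pmf N p)
          {W. (- \<theta>) * (real m * q) \<le> (- \<theta>) * real (edge_count W S)}"
    using \<theta> by (intro measure_pmf.finite_measure_mono) auto
  also have "\<dots> \<le> (1 - r + r * exp (- \<theta>)) ^ m / exp ((- \<theta>) * (real m * q))"
    unfolding m_def using q by (intro prob_edge_count_chernoff[OF S _ _ p]) auto
  also have "\<dots> \<le> exp (r * (\<theta>\<^sup>2 - \<theta>)) ^ m / exp ((- \<theta>) * (real m * q))"
    using q base by (intro divide_right_mono power_mono) (auto intro: add_nonneg_nonneg)
  also have "\<dots> = exp (real m * (r * \<theta>\<^sup>2 - \<theta> * (r - q)))"
    unfolding exp_of_nat_mult[symmetric] exp_diff[symmetric] by (simp add: algebra_simps)
  also have "r * \<theta>\<^sup>2 - \<theta> * (r - q) = - ((r - q)\<^sup>2 / (4 * r))"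
    using q by (simp add: \<theta>_def field_simps power2_eq_square)
  finally show ?thesis by simp
qed

section \<open>Union bound and risk of the scan test\<close>

lemma finite_communities: "finite (communities N n)"
  by (rule finite_subset[of _ "Pow {1..N}"]) (auto simp: communities_def)

lemma card_communities: "card (communities N n) = N choose n"
  using n_subsets[of "{1..N}" n] by (simp add: communities_def)

lemma communities_nonempty: "n \<le> N \<Longrightarrow> communities N n \<noteq> {}"
  using card_communities[of N n]
  by (metis card.empty zero_less_binomial_iff less_numeral_extra(3))

text \<open>Divided by \<open>fact n\<close>, the left side is a single term of the exponential
  series at \<open>n\<close>.\<close>

lemma power_self_le_fact_mult_exp: "real n ^ n \<le> fact n * exp (real n)"
proof -
  have sums: "(\<lambda>k. real n ^ k /\<^sub>R fact k) sums exp (real n)" by (rule exp_converges)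
  have "(\<Sum>k\<in>{n}. real n ^ k /\<^sub>R fact k) \<le> (\<Sum>k. real n ^ k /\<^sub>R fact k)"
    using sums by (intro sum_le_suminf) (auto simp: sums_iff)
  then show ?thesis using sums by (simp add: sums_iff field_simps)
qed

text \<open>The familiar bound \<open>(e * N / n) ^ n\<close>, from
  \<open>N choose n \<le> N ^ n / fact n\<close> and
  \<open>fact n \<ge> (n / e) ^ n\<close>.\<close>

lemma binomial_le_exp:
  assumes "0 < n" "0 < N"
  shows "real (N choose n) \<le> exp (real n * (1 + ln (real N / real n)))"
proof -
  have "real (N choose n) * real n ^ n \<le> real (N choose n) * (fact n * exp (real n))"
    by (intro mult_left_mono power_self_le_fact_mult_exp) auto
  also have "\<dots> = real ((N choose n) * fact n) * exp (real n)" by simp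
  also have "\<dots> \<le> real (N ^ n) * exp (real n)"
    by (intro mult_right_mono of_nat_mono binomial_fact_pow) auto
  finally have "real (N choose n) \<le> (real N / real n) ^ n * exp (real n)"
    using assms by (simp add: field_simps power_divide)
  also have "\<dots> = exp (real n * (1 + ln (real N / real n)))"
    using assms by (simp add: distrib_left exp_add exp_of_nat_mult)
  finally show ?thesis .
qed

text \<open>Under the null a union bound runs over all \<open>N choose n\<close> candidate sets.
  Under the alternative the scan is at least the count on the planted \<open>S\<close>, so only that
  count matters.\<close>

lemma risk_scan_test_le:
  assumes n: "0 < n" "n \<le> N" and p: "0 < p0" "p0 < q" "q < p1" "p1 \<le> 1"
  defines "m \<equiv> n choose 2"
  shows "risk N n p0 p1 (scan_test N n (real m * q))
    \<le> exp (real n * (1 + ln (real N / real n)) - real m * entropy_fn p0 q)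
      + exp (- real m * ((p1 - q)\<^sup>2 / (4 * p1)))"
proof -
  define t where "t = real m * q"
  have ne: "communities N n \<noteq> {}" using n(2) by (rule communities_nonempty)
  have "measure_pmf.prob (null_pmf N p0) {W. scan_test N n t W = 1}
      \<le> measure_pmf.prob (null_pmf N p0) (\<Union>S\<in>communities N n. {W. t \<le> real (edge_count W S)})"
  proof (intro measure_pmf.finite_measure_mono subsetI)
    fix W assume "W \<in> {W. scan_test N n t W = 1}"
    then have "t \<le> real (scan_stat N n W)" by (simp add: scan_test_def split: if_splits)
    moreover have "scan_stat N n W \<in> edge_count W ` communities N n"
      unfolding scan_stat_def using ne by (intro Max_in) (auto simp: finite_communities)
    ultimately show "W \<in> (\<Union>S\<in>communities N n. {W. t \<le> real (edge_count W S)})" by auto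
  qed simp
  also have "\<dots> \<le> (\<Sum>S\<in>communities N n. measure_pmf.prob (null_pmf N p0) {W. t \<le> real (edge_count W S)})"
    by (intro measure_pmf.finite_measure_subadditive_finite) (auto simp: finite_communities)
  also have "\<dots> \<le> (\<Sum>S\<in>communities N n. exp (- real m * entropy_fn p0 q))"
  proof (intro sum_mono)
    fix S assume "S \<in> communities N n"
    then show "measure_pmf.prob (null_pmf N p0) {W. t \<le> real (edge_count W S)}
        \<le> exp (- real m * entropy_fn p0 q)"
      using prob_edge_count_ge[of S N p0 q "\<lambda>i j. p0"] p
      by (auto simp: communities_def null_pmf_def t_def m_def)
  qed
  also have "\<dots> = real (N choose n) * exp (- real m * entropy_fn p0 q)"
    by (simp add: card_communities)
  also have "\<dots> \<le> exp (real n * (1 + ln (real N / real n))) * exp (- real m * entropy_fn p0 q)"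
    using n by (intro mult_right_mono binomial_le_exp) auto
  also have "\<dots> = exp (real n * (1 + ln (real N / real n)) - real m * entropy_fn p0 q)"
    by (simp add: exp_add[symmetric])
  finally have null: "measure_pmf.prob (null_pmf N p0) {W. scan_test N n t W = 1} \<le> \<dots>" .
  have "Max ((\<lambda>S. measure_pmf.prob (alt_pmf N p0 p1 S) {W. scan_test N n t W = 0}) ` communities N n)
      \<le> exp (- real m * ((p1 - q)\<^sup>2 / (4 * p1)))"
  proof (intro Max.boundedI)
    fix x assume "x \<in> (\<lambda>S. measure_pmf.prob (alt_pmf N p0 p1 S) {W. scan_test N n t W = 0}) ` communities N n"
    then obtain S where S: "S \<in> communities N n"
      and x: "x = measure_pmf.prob (alt_pmf N p0 p1 S) {W. scan_test N n t W = 0}" by auto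
    have "x \<le> measure_pmf.prob (alt_pmf N p0 p1 S) {W. real (edge_count W S) < t}"
      unfolding x
    proof (intro measure_pmf.finite_measure_mono subsetI)
      fix W assume "W \<in> {W. scan_test N n t W = 0}"
      then have "real (scan_stat N n W) < t" by (simp add: scan_test_def split: if_splits)
      moreover have "edge_count W S \<le> scan_stat N n W"
        unfolding scan_stat_def using S by (intro Max_ge) (auto simp: finite_communities)
      ultimately show "W \<in> {W. real (edge_count W S) < t}" by simp
    qed simp
    also have "\<dots> \<le> exp (- real m * ((p1 - q)\<^sup>2 / (4 * p1)))"
      using prob_edge_count_less[of S N p1 q "\<lambda>i j. if i \<in> S \<and> j \<in> S then p1 else p0"] p S
      by (auto simp: communities_def alt_pmf_def t_def m_def)
    finally show "x \<le> exp (- real m * ((p1 - q)\<^sup>2 / (4 * p1)))" .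
  qed (use ne in \<open>auto simp: finite_communities\<close>)
  with null show ?thesis unfolding risk_def t_def by linarith
qed

text \<open>The lower half of the final sandwich; \<open>n \<le> N\<close> supplies a community, so
  that the maximum is meaningful.\<close>

lemma risk_nonneg:
  assumes "n \<le> N"
  shows "0 \<le> risk N n p0 p1 T"
proof -
  obtain S where "S \<in> communities N n" using communities_nonempty[OF assms] by blast
  then have "measure_pmf.prob (alt_pmf N p0 p1 S) {W. T W = 0}
      \<le> Max ((\<lambda>S. measure_pmf.prob (alt_pmf N p0 p1 S) {W. T W = 0}) ` communities N n)"
    by (intro Max_ge) (auto simp: finite_communities)
  then have "0 \<le> Max ((\<lambda>S. measure_pmf.prob (alt_pmf N p0 p1 S) {W. T W = 0}) ` communities N n)"
    by (rule order_trans[OF measure_nonneg])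
  then show ?thesis by (simp add: risk_def)
qed

section \<open>Uniform risk bound and passage to the limit\<close>

lemma real_choose_two: "real (n choose 2) = real n * (real n - 1) / 2"
  by (induction n) (auto simp: numeral_2_eq_2 field_simps)

text \<open>The last two terms bound the missed detections in the two regimes of
  \<open>min_le_square_diff_div\<close>.\<close>

lemma risk_scan_test_le_exp_sum:
  assumes n: "2 \<le> n" "n \<le> N"
    and p: "0 < p0" "p0 < p1" "p1 \<le> 1" "p0 \<le> c" "c < 1"
    and a: "1 < b" "1 < a" "0 < s" "12 * s < 1" "b \<le> (1 - 12 * s) * a"
    and signal: "a * (2 * ln (real N / real n)) \<le> real n * entropy_fn p0 p1"
    and large: "2 * b / (b - 1) \<le> real n" "4 / (b - 1) \<le> ln (real N / real n)"
      "1 \<le> ln (real N / real n)"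
  shows "risk N n p0 p1 (scan_test N n (real (n choose 2) * (p1 - s\<^sup>2 * (p1 - p0))))
    \<le> exp (- real n) + (exp (- (s ^ 4 / 64 * ((real n)\<^sup>2 * p1))) + exp (- (s ^ 4 * (1 - c) / 16 * real n)))"
proof -
  define L where "L = ln (real N / real n)"
  define m where "m = real (n choose 2)"
  \<comment> \<open>Contraction with \<open>l = s\<^sup>2\<close>, so that the entropy keeps the
    factor \<open>1 - 12 * s\<close>.\<close>
  define q where "q = p1 - s\<^sup>2 * (p1 - p0)"
  define H where "H = entropy_fn p0 p1"
  have m: "m = real n * (real n - 1) / 2" "0 \<le> m"
    by (simp add: m_def real_choose_two) (simp add: m_def)
  have s: "0 < s\<^sup>2" "s\<^sup>2 < 1" using a by (auto simp: power_less_one_iff)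
  have "s\<^sup>2 * (p1 - p0) < 1 * (p1 - p0)" using s p by (intro mult_strict_right_mono) auto
  moreover have "0 < s\<^sup>2 * (p1 - p0)" using s p by simp
  ultimately have q: "p0 < q" "q < p1" by (auto simp: q_def algebra_simps)
  have L: "1 \<le> L" using large by (simp add: L_def)
  have nL: "0 \<le> (real n - 1) * L" using n L by simp
  have mH: "(real n - 1) * (a * L) \<le> m * H"
  proof -
    have "(real n - 1) / 2 * (a * (2 * L)) \<le> (real n - 1) / 2 * (real n * H)"
      using signal n unfolding L_def H_def by (intro mult_left_mono) auto
    also have "\<dots> = m * H" by (simp add: m(1))
    finally show ?thesis by simp
  qed
  have "(1 - 12 * s) * H \<le> entropy_fn p0 q"
    using entropy_fn_contract[of p0 p1 "s\<^sup>2"] p s a by (simp add: q_def H_def)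
  then have "m * ((1 - 12 * s) * H) \<le> m * entropy_fn p0 q" using m by (intro mult_left_mono)
  moreover have "(1 - 12 * s) * ((real n - 1) * (a * L)) \<le> (1 - 12 * s) * (m * H)"
    using mH a by (intro mult_left_mono) auto
  moreover have "b * ((real n - 1) * L) \<le> (1 - 12 * s) * a * ((real n - 1) * L)"
    using a nL by (intro mult_right_mono) auto
  ultimately have mHq: "b * ((real n - 1) * L) \<le> m * entropy_fn p0 q" by (simp add: mult_ac)
  \<comment> \<open>The surplus \<open>(b - 1) * n * L\<close> is split in halves: one absorbs
    \<open>b * L\<close> as \<open>n\<close> is large, the other \<open>2 * n\<close> as
    \<open>L\<close> is large.\<close>
  have "b * L \<le> (b - 1) * real n / 2 * L"
    using large(1) a L by (intro mult_right_mono) (auto simp: field_simps)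
  moreover have "4 * real n \<le> (b - 1) * L * real n"
    using large(2) a by (intro mult_right_mono) (auto simp: L_def field_simps)
  ultimately have "real n * (1 + L) - b * ((real n - 1) * L) \<le> - real n"
    by (simp add: algebra_simps)
  then have null: "real n * (1 + L) - m * entropy_fn p0 q \<le> - real n" using mHq by linarith
  \<comment> \<open>As \<open>n \<le> 2 * (n - 1)\<close>, the signal condition also makes
    \<open>m * H\<close> at least of order \<open>n\<close>; this serves the regime of comparable
    \<open>p0\<close> and \<open>p1\<close>.\<close>
  have "real n * 1 \<le> 2 * (real n - 1) * (a * L)"
    using n a L mult_mono[of 1 a 1 L] by (intro mult_mono) auto
  then have n_mH: "real n / 2 \<le> m * H" using mH by linarith
  have "2 * real n \<le> real n * real n" using n by (intro mult_right_mono) auto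
  then have n2: "(real n)\<^sup>2 / 4 \<le> m" by (simp add: m(1) power2_eq_square field_simps)
  have "min ((real n)\<^sup>2 / 4 * (p1 / 4)) ((1 - c) / 2 * (real n / 2))
      \<le> min (m * (p1 / 4)) ((1 - c) / 2 * (m * H))"
    using n2 n_mH m(2) p by (intro min.mono mult_mono) auto
  also have "\<dots> = m * min (p1 / 4) ((1 - c) / 2 * H)"
    using m(2) by (simp add: min_mult_distrib_left mult_ac)
  also have "\<dots> \<le> m * ((p1 - p0)\<^sup>2 / p1)"
    using p m(2) unfolding H_def by (intro mult_left_mono min_le_square_diff_div)
  finally have "s ^ 4 / 4 * min ((real n)\<^sup>2 / 4 * (p1 / 4)) ((1 - c) / 2 * (real n / 2))
      \<le> s ^ 4 / 4 * (m * ((p1 - p0)\<^sup>2 / p1))"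
    using a by (intro mult_left_mono) auto
  also have "\<dots> = m * ((p1 - q)\<^sup>2 / (4 * p1))"
    by (simp add: q_def power_mult_distrib power2_eq_square power4_eq_xxxx)
  \<comment> \<open>Whichever term attains the minimum, one of the two exponentials bounds the type
    II error; adding both avoids splitting the sequence by regime.\<close>
  finally have alt: "s ^ 4 / 64 * ((real n)\<^sup>2 * p1) \<le> m * ((p1 - q)\<^sup>2 / (4 * p1))
      \<or> s ^ 4 * (1 - c) / 16 * real n \<le> m * ((p1 - q)\<^sup>2 / (4 * p1))"
    by (auto simp: min_def algebra_simps split: if_splits)
  have "risk N n p0 p1 (scan_test N n (m * q))
    \<le> exp (real n * (1 + L) - m * entropy_fn p0 q) + exp (- m * ((p1 - q)\<^sup>2 / (4 * p1)))"
    unfolding m_def L_def using n p q by (intro risk_scan_test_le) auto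
  moreover have "exp (real n * (1 + L) - m * entropy_fn p0 q) \<le> exp (- real n)" using null by simp
  moreover have "exp (- m * ((p1 - q)\<^sup>2 / (4 * p1)))
      \<le> exp (- (s ^ 4 / 64 * ((real n)\<^sup>2 * p1))) + exp (- (s ^ 4 * (1 - c) / 16 * real n))"
    using alt by (metis add_increasing add_increasing2 exp_ge_zero exp_le_cancel_iff mult_minus_left neg_le_iff_le)
  ultimately show ?thesis unfolding m_def q_def by linarith
qed

theorem proposition3:
  fixes n :: "nat \<Rightarrow> nat" and p0 p1 :: "nat \<Rightarrow> real"
  assumes probs: "\<And>N. 0 < p0 N \<and> p0 N < p1 N \<and> p1 N \<le> 1"
    and n_small: "(\<lambda>N. real (n N) / real N) \<longlonglongrightarrow> 0"
    and p0_bounded: "\<exists>c<1. \<forall>N. p0 N \<le> c"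
    and N2p0: "filterlim (\<lambda>N. (real N)\<^sup>2 * p0 N) at_top sequentially"
    and n_large: "filterlim n at_top sequentially"
    and n2p1: "filterlim (\<lambda>N. (real (n N))\<^sup>2 * p1 N) at_top sequentially"
    and signal: "liminf (\<lambda>N. ereal (real (n N) * entropy_fn (p0 N) (p1 N)
                                     / (2 * ln (real N / real (n N))))) > 1"
  shows "\<exists>t :: nat \<Rightarrow> real.
           (\<lambda>N. risk N (n N) (p0 N) (p1 N) (scan_test N (n N) (t N))) \<longlonglongrightarrow> 0"
proof -
  obtain c where c: "c < 1" "\<And>N. p0 N \<le> c" using p0_bounded by blast
  obtain a where a: "1 < a" and signal_a: "ereal a < liminf (\<lambda>N. ereal (real (n N) *
      entropy_fn (p0 N) (p1 N) / (2 * ln (real N / real (n N)))))"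
    using ereal_dense2[OF signal] by (auto simp: one_ereal_def)
  \<comment> \<open>\<open>b\<close> is the midpoint of 1 and \<open>a\<close>, and \<open>s\<close>
    solves \<open>(1 - 12 * s) * a = b\<close>: the contraction spends half of the margin in the
    signal condition.\<close>
  define b s where "b = (1 + a) / 2" and "s = (1 - b / a) / 12"
  have bs: "1 < b" "0 < s" "12 * s < 1" "b \<le> (1 - 12 * s) * a"
  proof -
    have "b / a < 1" "0 < b / a" using a by (auto simp: b_def)
    then show "1 < b" "0 < s" "12 * s < 1" using a by (auto simp: b_def s_def)
    have "1 - 12 * s = b / a" by (simp add: s_def del: right_diff_distrib_numeral)
    then show "b \<le> (1 - 12 * s) * a" using a by simp
  qed
  have n_real: "filterlim (\<lambda>N. real (n N)) at_top sequentially"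
    by (rule filterlim_compose[OF filterlim_real_sequentially n_large])
  have ev_n: "eventually (\<lambda>N. K \<le> real (n N)) sequentially" for K
    using n_real by (simp add: filterlim_at_top)
  have ev_le: "eventually (\<lambda>N. n N \<le> N) sequentially"
    using order_tendstoD(2)[OF n_small zero_less_one] eventually_gt_at_top[of "0::nat"]
    by eventually_elim (simp add: field_simps)
  \<comment> \<open>Reciprocals of a null sequence tend to plus infinity only if it is eventually
    positive.\<close>
  have "eventually (\<lambda>N. 0 < real (n N) / real N) sequentially"
    using ev_n[of 1] eventually_gt_at_top[of "0::nat"] by eventually_elim simp
  then have "filterlim (\<lambda>N. inverse (real (n N) / real N)) at_top sequentially"
    by (rule filterlim_inverse_at_top[OF n_small])
  then have "filterlim (\<lambda>N. ln (real N / real (n N))) at_top sequentially"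
    by (intro filterlim_compose[OF ln_at_top]) (simp add: inverse_divide)
  then have ev_L: "eventually (\<lambda>N. K \<le> ln (real N / real (n N))) sequentially" for K
    by (simp add: filterlim_at_top)
  define t where "t N = real (n N choose 2) * (p1 N - s\<^sup>2 * (p1 N - p0 N))" for N
  define u where "u N = exp (- real (n N)) + (exp (- (s ^ 4 / 64 * ((real (n N))\<^sup>2 * p1 N)))
    + exp (- (s ^ 4 * (1 - c) / 16 * real (n N))))" for N
  have upper: "eventually (\<lambda>N. risk N (n N) (p0 N) (p1 N) (scan_test N (n N) (t N)) \<le> u N) sequentially"
    using ev_le ev_n[of 2] ev_n[of "2 * b / (b - 1)"] ev_L[of "4 / (b - 1)"] ev_L[of 1]
      less_LiminfD[OF signal_a]
  proof eventually_elim
    case (elim N)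
    have "0 < 2 * ln (real N / real (n N))" using elim by linarith
    from pos_less_divide_eq[OF this, of a] elim
    have "a * (2 * ln (real N / real (n N))) \<le> real (n N) * entropy_fn (p0 N) (p1 N)" by simp
    then show ?case unfolding t_def u_def using elim probs[of N] c a bs
      by (intro risk_scan_test_le_exp_sum[where a = a and b = b]) auto
  qed
  have lim: "(\<lambda>N. exp (- (K * f N))) \<longlonglongrightarrow> 0"
    if "0 < K" "filterlim f at_top sequentially" for K :: real and f :: "nat \<Rightarrow> real"
    using that by (intro filterlim_compose[OF exp_at_bot] filterlim_compose[OF filterlim_uminus_at_bot_at_top]
        filterlim_tendsto_pos_mult_at_top[OF tendsto_const])
  have "u \<longlonglongrightarrow> 0 + (0 + 0)"
    unfolding u_def using lim[OF _ n2p1, of "s ^ 4 / 64"] lim[OF _ n_real, of "s ^ 4 * (1 - c) / 16"]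
      lim[OF _ n_real, of 1] bs c by (intro tendsto_add) auto
  then have u: "u \<longlonglongrightarrow> 0" by simp
  have "eventually (\<lambda>N. 0 \<le> risk N (n N) (p0 N) (p1 N) (scan_test N (n N) (t N))) sequentially"
    using ev_le by eventually_elim (rule risk_nonneg)
  from tendsto_sandwich[OF this upper tendsto_const u]
  show ?thesis by blast
qed

end
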